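(* Let $d \geq 2$ be an integer. If $\varphi$ is an edge precoloring of at most $d-1$ edges of the hypercube $Q_d$ (with colors from $\{1,\dots,d\}$), then $\varphi$ can be extended to a proper $d$-edge coloring of $Q_d$.
   Context: $Q_d$ is the $d$-dimensional hypercube graph. All (partial) edge colorings are proper: adjacent colored edges receive distinct colors. An edge precoloring of a graph $G$ is a proper edge coloring of some subset $E' \subseteq E(G)$. A proper $d$-edge coloring is a proper edge coloring of all edges using colors from $\{1,\dots,d\}$. A precoloring $\varphi$ of edges of $Q_d$ is extended to a proper $d$-edge coloring $f$ of $Q_d$ if $f(e)=\varphi(e)$ for every edge $e$ colored under $\varphi$. *)

theory Defs
  imports Main "HOL-Library.FuncSet"
begin

text \<open>The vertex set \<open>{0,1}\<^sup>d\<close>: extensional Boolean functions on the index set \<open>{..<d}\<close>.\<close>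

definition hypercube_verts :: "nat \<Rightarrow> (nat \<Rightarrow> bool) set" where
  "hypercube_verts d = {..<d} \<rightarrow>\<^sub>E UNIV"

definition hypercube_edges :: "nat \<Rightarrow> (nat \<Rightarrow> bool) set set" where
  "hypercube_edges d =
     {{x, y} | x y. x \<in> hypercube_verts d \<and> y \<in> hypercube_verts d \<and>
                    card {i \<in> {..<d}. x i \<noteq> y i} = 1}"

text \<open>Edges are two-element vertex sets, so distinct edges are adjacent iff they intersect.\<close>

definition proper_edge_coloring_on :: "'v set set \<Rightarrow> ('v set \<Rightarrow> nat) \<Rightarrow> bool" where
  "proper_edge_coloring_on E f \<longleftrightarrow>
     (\<forall>e\<in>E. \<forall>e'\<in>E. e \<noteq> e' \<and> e \<inter> e' \<noteq> {} \<longrightarrow> f e \<noteq> f e')"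

text \<open>In a graph with edge set \<open>E\<close>; the precolored edges are \<open>dom \<phi>\<close>.\<close>

definition edge_precoloring :: "'v set set \<Rightarrow> nat set \<Rightarrow> ('v set \<rightharpoonup> nat) \<Rightarrow> bool" where
  "edge_precoloring E C \<phi> \<longleftrightarrow>
     dom \<phi> \<subseteq> E \<and> ran \<phi> \<subseteq> C \<and> proper_edge_coloring_on (dom \<phi>) (\<lambda>e. the (\<phi> e))"

text \<open>Values of \<open>f\<close> outside \<open>E\<close> are irrelevant.\<close>

definition proper_d_edge_coloring :: "'v set set \<Rightarrow> nat \<Rightarrow> ('v set \<Rightarrow> nat) \<Rightarrow> bool" where
  "proper_d_edge_coloring E d f \<longleftrightarrow>
     (\<forall>e\<in>E. f e \<in> {1..d}) \<and> proper_edge_coloring_on E f"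

definition extends_precoloring :: "('v set \<Rightarrow> nat) \<Rightarrow> ('v set \<rightharpoonup> nat) \<Rightarrow> bool" where
  "extends_precoloring f \<phi> \<longleftrightarrow> (\<forall>e\<in>dom \<phi>. \<phi> e = Some (f e))"

end

theory Submission
  imports Defs
begin

text \<open>
  The proof is an induction on the dimension, for an arbitrary set \<open>C\<close> of \<open>d\<close> colors. At most
  \<open>d - 1\<close> edges are precolored, so some direction \<open>i\<close> contains no precolored edge and some
  color \<open>c\<close> is not used. Direction \<open>i\<close> splits the cube into two halves of dimension \<open>d - 1\<close>,
  joined by a perfect matching of edges that are all uncolored.

  If both halves contain precolored edges, then each contains at most \<open>d - 2\<close> of them. The
  induction hypothesis colors each half with \<open>C - {c}\<close>, and the matching between the halves gets
  color \<open>c\<close>.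

  Otherwise one half contains all precolored edges, perhaps \<open>d - 1\<close> of them, so the induction
  hypothesis does not apply directly. Take a color \<open>a\<close> that is used by \<open>\<phi>\<close> and forget the edges
  precolored \<open>a\<close>. At most \<open>d - 2\<close> precolored edges remain, none of them of color \<open>a\<close>, so the
  half has an extension with colors \<open>C - {a}\<close>. The forgotten edges form a matching, hence
  they can be recolored \<open>a\<close> (\<open>recolor_matching\<close>). This gives a coloring of the half that extends
  \<open>\<phi>\<close>, has \<open>d\<close> colors, and misses exactly one color at each vertex. Copying it to
  the other half and giving each edge between the halves the color missing at its ends completes
  the coloring (\<open>extend_from_half\<close>).

  The induction runs over the subcubes of a fixed cube, so that both halves are subgraphs and a
  precoloring of the cube restricts to them without any relabeling of vertices.
\<close>

section \<open>Subcubes\<close>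

definition subcube :: "'a set \<Rightarrow> ('a \<Rightarrow> bool) \<Rightarrow> ('a \<Rightarrow> bool) set" where
  "subcube J v = {x. \<forall>k. k \<notin> J \<longrightarrow> x k = v k}"

definition edge_at :: "('a \<Rightarrow> bool) \<Rightarrow> 'a \<Rightarrow> ('a \<Rightarrow> bool) set" where
  "edge_at x i = {x, x(i := \<not> x i)}"

definition subcube_edges :: "'a set \<Rightarrow> ('a \<Rightarrow> bool) \<Rightarrow> ('a \<Rightarrow> bool) set set" where
  "subcube_edges J v = {edge_at x i | x i. x \<in> subcube J v \<and> i \<in> J}"

lemma edge_at_direction_unique:
  assumes "edge_at x i = edge_at y j"
  shows "i = j"
proof (rule ccontr)
  assume "i \<noteq> j"
  then have const: "z i = y i" if "z \<in> edge_at y j" for z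
    using that by (auto simp: edge_at_def)
  have "x \<in> edge_at x i" "x(i := \<not> x i) \<in> edge_at x i"
    by (simp_all add: edge_at_def)
  from this[unfolded assms, THEN const] show False by simp
qed

lemma edge_at_other_end: "z \<in> edge_at x i \<Longrightarrow> edge_at z i = edge_at x i"
  by (auto simp: edge_at_def)

lemma edge_at_subset_subcube:
  "x \<in> subcube J v \<Longrightarrow> i \<in> J \<Longrightarrow> edge_at x i \<subseteq> subcube J v"
  by (auto simp: edge_at_def subcube_def)

lemma subcube_edgeE:
  assumes "e \<in> subcube_edges J v" "z \<in> e"
  obtains i where "z \<in> subcube J v" "i \<in> J" "e = edge_at z i"
proof -
  obtain x i where xi: "x \<in> subcube J v" "i \<in> J" "e = edge_at x i"
    using assms(1) by (auto simp: subcube_edges_def)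
  have "e = edge_at z i" using edge_at_other_end[of z x i] assms(2) xi(3) by simp
  moreover have "z \<in> subcube J v"
    using edge_at_subset_subcube[OF xi(1,2)] assms(2) xi(3) by auto
  ultimately show thesis using that xi(2) by simp
qed

lemma edge_at_in_subcube_edges:
  "x \<in> subcube J v \<Longrightarrow> i \<in> J \<Longrightarrow> edge_at x i \<in> subcube_edges J v"
  by (auto simp: subcube_edges_def)

text \<open>Properness is a local condition: two distinct edges meet only if they leave a common vertex
  in different directions.\<close>

lemma proper_on_subcube_iff:
  "proper_edge_coloring_on (subcube_edges J v) f \<longleftrightarrow>
     (\<forall>x\<in>subcube J v. inj_on (\<lambda>i. f (edge_at x i)) J)"
proof
  assume proper: "proper_edge_coloring_on (subcube_edges J v) f"
  show "\<forall>x\<in>subcube J v. inj_on (\<lambda>i. f (edge_at x i)) J"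
  proof (intro ballI inj_onI)
    fix x i j
    assume x: "x \<in> subcube J v" and ij: "i \<in> J" "j \<in> J"
      and eq: "f (edge_at x i) = f (edge_at x j)"
    have "x \<in> edge_at x i \<inter> edge_at x j" by (simp add: edge_at_def)
    then have "edge_at x i = edge_at x j"
      using proper eq edge_at_in_subcube_edges[OF x ij(1)] edge_at_in_subcube_edges[OF x ij(2)]
      unfolding proper_edge_coloring_on_def by blast
    then show "i = j" by (rule edge_at_direction_unique)
  qed
next
  assume inj: "\<forall>x\<in>subcube J v. inj_on (\<lambda>i. f (edge_at x i)) J"
  show "proper_edge_coloring_on (subcube_edges J v) f"
    unfolding proper_edge_coloring_on_def
  proof (intro ballI impI)
    fix e e'
    assume e: "e \<in> subcube_edges J v" "e' \<in> subcube_edges J v" and "e \<noteq> e' \<and> e \<inter> e' \<noteq> {}"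
    then obtain z where z: "z \<in> e" "z \<in> e'" and "e \<noteq> e'" by blast
    obtain i where i: "z \<in> subcube J v" "i \<in> J" "e = edge_at z i"
      using subcube_edgeE[OF e(1) z(1)] .
    obtain j where j: "j \<in> J" "e' = edge_at z j"
      using subcube_edgeE[OF e(2) z(2)] .
    show "f e \<noteq> f e'"
      using inj i j \<open>e \<noteq> e'\<close> by (auto dest: inj_onD)
  qed
qed

lemma edge_at_in_half_iff:
  assumes "i \<in> J" "x \<in> subcube J v" "j \<in> J"
  shows "edge_at x j \<in> subcube_edges (J - {i}) (v(i := b)) \<longleftrightarrow> j \<noteq> i \<and> x i = b"
proof
  assume half: "edge_at x j \<in> subcube_edges (J - {i}) (v(i := b))"
  have "x \<in> edge_at x j" by (simp add: edge_at_def)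
  then obtain k where k: "x \<in> subcube (J - {i}) (v(i := b))" "k \<in> J - {i}"
    "edge_at x j = edge_at x k"
    using subcube_edgeE[OF half] by blast
  have "j = k" using k(3) by (rule edge_at_direction_unique)
  then show "j \<noteq> i \<and> x i = b"
    using k(1,2) by (simp add: subcube_def)
next
  assume "j \<noteq> i \<and> x i = b"
  then show "edge_at x j \<in> subcube_edges (J - {i}) (v(i := b))"
    using assms by (intro edge_at_in_subcube_edges) (auto simp: subcube_def)
qed

lemma finite_unused_direction:
  assumes "finite D" "card D < card J"
  obtains i where "i \<in> J" "\<And>x. edge_at x i \<notin> D"
proof -
  let ?used = "{i \<in> J. \<exists>x. edge_at x i \<in> D}"
  have "\<forall>i\<in>?used. \<exists>x. edge_at x i \<in> D" by blast
  from bchoice[OF this] obtain w where w: "\<And>i. i \<in> ?used \<Longrightarrow> edge_at (w i) i \<in> D"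
    by blast
  have "card ?used \<le> card D"
  proof (rule card_inj_on_le)
    show "inj_on (\<lambda>i. edge_at (w i) i) ?used"
      by (rule inj_onI) (rule edge_at_direction_unique)
    show "(\<lambda>i. edge_at (w i) i) ` ?used \<subseteq> D" using w by blast
    show "finite D" by fact
  qed
  then have "?used \<noteq> J" using assms(2) by auto
  then show thesis using that by blast
qed

section \<open>Coloring a cube from its halves\<close>

definition proper_edge_coloring_with :: "'v set set \<Rightarrow> nat set \<Rightarrow> ('v set \<Rightarrow> nat) \<Rightarrow> bool" where
  "proper_edge_coloring_with E C f \<longleftrightarrow> (\<forall>e\<in>E. f e \<in> C) \<and> proper_edge_coloring_on E f"

lemma recolor_matching:
  assumes "proper_edge_coloring_with E (C - {a}) f" "a \<in> C"
    and "\<And>e e'. e \<in> A \<Longrightarrow> e' \<in> A \<Longrightarrow> e \<noteq> e' \<Longrightarrow> e \<inter> e' = {}"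
  shows "proper_edge_coloring_with E C (\<lambda>e. if e \<in> A then a else f e)"
  unfolding proper_edge_coloring_with_def proper_edge_coloring_on_def
proof (intro conjI ballI impI)
  fix e assume "e \<in> E"
  then show "(if e \<in> A then a else f e) \<in> C"
    using assms(1,2) by (simp add: proper_edge_coloring_with_def)
next
  fix e e' assume e: "e \<in> E" "e' \<in> E" "e \<noteq> e' \<and> e \<inter> e' \<noteq> {}"
  then have "f e \<noteq> f e'" "f e \<noteq> a" "f e' \<noteq> a"
    using assms(1) by (auto simp: proper_edge_coloring_with_def proper_edge_coloring_on_def)
  moreover have "\<not> (e \<in> A \<and> e' \<in> A)"
    using assms(3) e(3) by blast
  ultimately show "(if e \<in> A then a else f e) \<noteq> (if e' \<in> A then a else f e')"
    by simp
qed

lemma inj_on_remove_iff: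
  assumes "i \<in> J"
  shows "inj_on h J \<longleftrightarrow> inj_on h (J - {i}) \<and> h i \<notin> h ` (J - {i})"
  using inj_on_insert[of h i "J - {i}"] assms by (simp only: insert_Diff Diff_idemp)

lemma color_from_two_halves:
  assumes i: "i \<in> J" and c: "c \<in> C"
    and f: "\<And>b. proper_edge_coloring_with (subcube_edges (J - {i}) (v(i := b))) (C - {c}) (f b)"
  obtains F where "proper_edge_coloring_with (subcube_edges J v) C F"
    "\<And>b e. e \<in> subcube_edges (J - {i}) (v(i := b)) \<Longrightarrow> F e = f b e"
proof -
  let ?H = "\<lambda>b. subcube_edges (J - {i}) (v(i := b))"
  define F where "F e = (if e \<in> ?H True then f True e else if e \<in> ?H False then f False e else c)"
    for e
  have F_across: "F (edge_at x i) = c" if "x \<in> subcube J v" for x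
    using that edge_at_in_half_iff[OF i] i by (simp add: F_def)
  have F_inside: "F (edge_at x j) = f (x i) (edge_at x j)"
    if "x \<in> subcube J v" "j \<in> J" "j \<noteq> i" for x j
    using that edge_at_in_half_iff[OF i] by (simp add: F_def)
  have F_half: "F e = f b e" if e: "e \<in> ?H b" for b e
  proof -
    obtain x j where x: "x \<in> subcube (J - {i}) (v(i := b))" "j \<in> J - {i}" "e = edge_at x j"
      using e by (auto simp: subcube_edges_def)
    moreover have "x \<in> subcube J v" "x i = b"
      using x(1) i by (auto simp: subcube_def)
    ultimately show ?thesis using F_inside by auto
  qed
  have f_colors: "f (x i) (edge_at x j) \<in> C - {c}"
    if "x \<in> subcube J v" "j \<in> J" "j \<noteq> i" for x j
    using f that edge_at_in_half_iff[OF i] by (simp add: proper_edge_coloring_with_def)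
  have "inj_on (\<lambda>j. F (edge_at x j)) J" if x: "x \<in> subcube J v" for x
  proof -
    have "x \<in> subcube (J - {i}) (v(i := x i))"
      using x by (auto simp: subcube_def)
    then have "inj_on (\<lambda>j. f (x i) (edge_at x j)) (J - {i})"
      using f by (simp add: proper_edge_coloring_with_def proper_on_subcube_iff)
    then have "inj_on (\<lambda>j. F (edge_at x j)) (J - {i})"
      using F_inside[OF x] by (simp add: inj_on_def)
    moreover have "F (edge_at x j) \<noteq> F (edge_at x i)" if "j \<in> J - {i}" for j
      using F_across[OF x] F_inside[OF x, of j] f_colors[OF x, of j] that by auto
    ultimately show ?thesis
      unfolding inj_on_remove_iff[OF i, of "\<lambda>j. F (edge_at x j)"] by fastforce
  qed
  moreover have "F e \<in> C" if "e \<in> subcube_edges J v" for e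
  proof -
    obtain x j where x: "x \<in> subcube J v" "j \<in> J" "e = edge_at x j"
      using \<open>e \<in> subcube_edges J v\<close> by (auto simp: subcube_edges_def)
    then show ?thesis
      using c F_across[OF x(1)] F_inside[OF x(1,2)] f_colors[OF x(1,2)] by (cases "j = i") auto
  qed
  ultimately have "proper_edge_coloring_with (subcube_edges J v) C F"
    by (simp add: proper_edge_coloring_with_def proper_on_subcube_iff)
  then show thesis using that F_half by blast
qed

text \<open>A half meets each of its vertices in one edge fewer than there are colors, so a color is
  missing at every vertex. The projection \<open>\<pi>\<close> onto the half sends the edges of direction \<open>i\<close> to
  single vertices and every other edge to an edge of the half; coloring an edge by its image, with
  the missing color for a single vertex, uses equal colors on the two copies of each edge.\<close>

lemma extend_from_half:
  assumes fin: "finite J" and i: "i \<in> J" and card: "card C = card J"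
    and g: "proper_edge_coloring_with (subcube_edges (J - {i}) (v(i := b))) C g"
  obtains F where "proper_edge_coloring_with (subcube_edges J v) C F"
    "\<And>e. e \<in> subcube_edges (J - {i}) (v(i := b)) \<Longrightarrow> F e = g e"
proof -
  let ?V = "subcube (J - {i}) (v(i := b))"
  let ?E = "subcube_edges (J - {i}) (v(i := b))"
  define \<pi> where "\<pi> x = x(i := b)" for x :: "'a \<Rightarrow> bool"
  have "\<exists>c. c \<in> C - (\<lambda>j. g (edge_at y j)) ` (J - {i})" for y
  proof -
    have "card ((\<lambda>j. g (edge_at y j)) ` (J - {i})) < card J"
      using fin i by (meson card_Diff1_less card_image_le finite_Diff le_less_trans)
    then have "\<not> C \<subseteq> (\<lambda>j. g (edge_at y j)) ` (J - {i})"
      using card card_mono[of "(\<lambda>j. g (edge_at y j)) ` (J - {i})" C] fin by fastforce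
    then show ?thesis by blast
  qed
  then obtain missing where missing: "\<And>y. missing y \<in> C - (\<lambda>j. g (edge_at y j)) ` (J - {i})"
    by metis
  define F where "F e = (if is_singleton (\<pi> ` e) then missing (the_elem (\<pi> ` e)) else g (\<pi> ` e))"
    for e
  have \<pi>_V: "\<pi> x \<in> ?V" if "x \<in> subcube J v" for x
    using that by (auto simp: \<pi>_def subcube_def)
  have F_across: "F (edge_at x i) = missing (\<pi> x)" for x
  proof -
    have "\<pi> ` edge_at x i = {\<pi> x}" by (auto simp: \<pi>_def edge_at_def)
    then show ?thesis by (simp add: F_def)
  qed
  have F_inside: "F (edge_at x j) = g (edge_at (\<pi> x) j)" if "j \<noteq> i" for x j
  proof -
    have "\<pi> ` edge_at x j = edge_at (\<pi> x) j"
      using that by (simp add: \<pi>_def edge_at_def fun_upd_twist)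
    moreover have "\<not> is_singleton (edge_at (\<pi> x) j)"
    proof
      assume "is_singleton (edge_at (\<pi> x) j)"
      then have "(\<pi> x)(j := \<not> \<pi> x j) = \<pi> x"
        by (auto simp: edge_at_def is_singleton_def)
      then show False by (metis fun_upd_same)
    qed
    ultimately show ?thesis by (simp add: F_def)
  qed
  have g_colors: "g (edge_at (\<pi> x) j) \<in> C" if "x \<in> subcube J v" "j \<in> J" "j \<noteq> i" for x j
    using g \<pi>_V[OF that(1)] that edge_at_in_subcube_edges
    by (fastforce simp: proper_edge_coloring_with_def)
  have "inj_on (\<lambda>j. F (edge_at x j)) J" if x: "x \<in> subcube J v" for x
  proof -
    have "inj_on (\<lambda>j. g (edge_at (\<pi> x) j)) (J - {i})"
      using g \<pi>_V[OF x] by (simp add: proper_edge_coloring_with_def proper_on_subcube_iff)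
    then have "inj_on (\<lambda>j. F (edge_at x j)) (J - {i})"
      using F_inside by (simp add: inj_on_def)
    moreover have "F (edge_at x j) \<noteq> F (edge_at x i)" if "j \<in> J - {i}" for j
    proof -
      have "g (edge_at (\<pi> x) j) \<noteq> missing (\<pi> x)"
        using missing[of "\<pi> x"] imageI[OF that] by (metis DiffD2)
      then show ?thesis using F_across F_inside that by simp
    qed
    ultimately show ?thesis
      unfolding inj_on_remove_iff[OF i, of "\<lambda>j. F (edge_at x j)"] by fastforce
  qed
  moreover have "F e \<in> C" if "e \<in> subcube_edges J v" for e
  proof -
    obtain x j where x: "x \<in> subcube J v" "j \<in> J" "e = edge_at x j"
      using \<open>e \<in> subcube_edges J v\<close> by (auto simp: subcube_edges_def)
    then show ?thesis
      using missing[of "\<pi> x"] F_across F_inside g_colors[OF x(1,2)] by (cases "j = i") auto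
  qed
  ultimately have "proper_edge_coloring_with (subcube_edges J v) C F"
    by (simp add: proper_edge_coloring_with_def proper_on_subcube_iff)
  moreover have "F e = g e" if e: "e \<in> ?E" for e
  proof -
    obtain x j where x: "x \<in> ?V" "j \<in> J - {i}" "e = edge_at x j"
      using e by (auto simp: subcube_edges_def)
    moreover have "\<pi> x = x"
      using x(1) by (simp add: \<pi>_def subcube_def fun_eq_iff)
    ultimately show ?thesis using F_inside by simp
  qed
  ultimately show thesis using that by blast
qed

section \<open>Extending a precoloring\<close>

lemma edge_precoloring_restrict:
  assumes "edge_precoloring E C \<phi>" "S \<inter> dom \<phi> \<subseteq> E'" "ran (\<phi> |` S) \<subseteq> C'"
  shows "edge_precoloring E' C' (\<phi> |` S)"
  using assms by (auto simp: edge_precoloring_def proper_edge_coloring_on_def)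

lemma extends_precoloring_restrict:
  "extends_precoloring f (\<phi> |` S) \<Longrightarrow> e \<in> S \<Longrightarrow> \<phi> e = Some c \<Longrightarrow> f e = c"
  by (force simp: extends_precoloring_def restrict_map_def)

text \<open>The color set \<open>C\<close> is arbitrary because the halves are colored with a color of \<open>C\<close> left
  out.\<close>

lemma extend_subcube_precoloring:
  assumes "finite J" "card J = n" "finite C" "card C = n"
    and "edge_precoloring (subcube_edges J v) C \<phi>" "finite (dom \<phi>)" "card (dom \<phi>) \<le> n - 1"
  shows "\<exists>f. proper_edge_coloring_with (subcube_edges J v) C f \<and> extends_precoloring f \<phi>"
  using assms
proof (induction n arbitrary: J C v \<phi>)
  case 0
  then show ?case
    by (auto simp: subcube_edges_def edge_precoloring_def proper_edge_coloring_with_def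
        proper_edge_coloring_on_def extends_precoloring_def)
next
  case (Suc n)
  note pre = Suc.prems(5) and fin = Suc.prems(6)
  have dom_le: "card (dom \<phi>) \<le> n" using Suc.prems(7) by simp
  obtain i where i: "i \<in> J" and free: "\<And>x. edge_at x i \<notin> dom \<phi>"
    using finite_unused_direction[OF fin, of J] dom_le Suc.prems(2) by auto
  let ?H = "\<lambda>b. subcube_edges (J - {i}) (v(i := b))"
  have J': "finite (J - {i})" "card (J - {i}) = n"
    using Suc.prems(1,2) i by auto
  have dom_half: "e \<in> ?H True \<or> e \<in> ?H False" if e: "e \<in> dom \<phi>" for e
  proof -
    have "e \<in> subcube_edges J v" using e pre by (auto simp: edge_precoloring_def)
    then obtain x j where x: "x \<in> subcube J v" "j \<in> J" "e = edge_at x j"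
      by (auto simp: subcube_edges_def)
    moreover have "j \<noteq> i" using free e x(3) by blast
    ultimately show ?thesis using edge_at_in_half_iff[OF i x(1,2)] by simp
  qed
  show ?case
  proof (cases "\<exists>b. dom \<phi> \<subseteq> ?H b")
    case True
    then obtain b where b: "dom \<phi> \<subseteq> ?H b" ..
    \<comment> \<open>If nothing is precolored, any color serves as \<open>a\<close>, and no edge has to be forgotten.\<close>
    obtain a where a: "a \<in> C" "dom \<phi> \<noteq> {} \<Longrightarrow> a \<in> ran \<phi>"
    proof (cases "dom \<phi> = {}")
      case True
      have "C \<noteq> {}" using Suc.prems(4) by auto
      then show thesis using True that by blast
    next
      case False
      then obtain e a where "\<phi> e = Some a" by blast
      then have "a \<in> ran \<phi>" by (rule ranI)
      then show thesis using that pre by (auto simp: edge_precoloring_def)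
    qed
    let ?A = "{e. \<phi> e = Some a}"
    let ?\<psi> = "\<phi> |` (- ?A)"
    have "ran ?\<psi> \<subseteq> C - {a}"
      using pre by (auto simp: edge_precoloring_def ran_def restrict_map_def split: if_splits)
    then have \<psi>: "edge_precoloring (?H b) (C - {a}) ?\<psi>"
      using b by (intro edge_precoloring_restrict[OF pre]) auto
    have \<psi>_finite: "finite (dom ?\<psi>)"
      unfolding dom_restrict using fin by (rule finite_Int[OF disjI1])
    have \<psi>_le: "card (dom ?\<psi>) \<le> n - 1"
    proof (cases "dom \<phi> = {}")
      case True
      then show ?thesis by simp
    next
      case False
      then obtain e where "\<phi> e = Some a" using a(2) by (auto simp: ran_def)
      then have "dom ?\<psi> \<subset> dom \<phi>" by (auto simp: restrict_map_def split: if_splits)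
      then have "card (dom ?\<psi>) < card (dom \<phi>)" using fin by (simp add: psubset_card_mono)
      then show ?thesis using dom_le by simp
    qed
    have C': "finite (C - {a})" "card (C - {a}) = n"
      using Suc.prems(3,4) a(1) by auto
    obtain f where f: "proper_edge_coloring_with (?H b) (C - {a}) f" "extends_precoloring f ?\<psi>"
      using Suc.IH[OF J' C' \<psi> \<psi>_finite \<psi>_le] by blast
    define g where "g e = (if e \<in> ?A then a else f e)" for e
    have "e \<inter> e' = {}" if "e \<in> ?A" "e' \<in> ?A" "e \<noteq> e'" for e e'
    proof -
      have "e \<in> dom \<phi>" "e' \<in> dom \<phi>" "the (\<phi> e) = the (\<phi> e')" using that by auto
      then show ?thesis
        using pre that(3) unfolding edge_precoloring_def proper_edge_coloring_on_def by blast
    qed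
    then have "proper_edge_coloring_with (?H b) C g"
      unfolding g_def by (intro recolor_matching[OF f(1) a(1)])
    then obtain F where F: "proper_edge_coloring_with (subcube_edges J v) C F"
        "\<And>e. e \<in> ?H b \<Longrightarrow> F e = g e"
      using extend_from_half[OF Suc.prems(1) i] Suc.prems(2,4) by metis
    have "\<phi> e = Some (F e)" if e: "e \<in> dom \<phi>" for e
    proof -
      have "F e = g e" using F(2) b e by blast
      then show ?thesis
        using e extends_precoloring_restrict[OF f(2)] by (auto simp: g_def)
    qed
    then show ?thesis using F(1) by (auto simp: extends_precoloring_def)
  next
    case False
    have "card (ran \<phi>) \<le> card (dom \<phi>)"
    proof -
      have "ran \<phi> = (\<lambda>e. the (\<phi> e)) ` dom \<phi>" by (force simp: ran_def dom_def)
      then show ?thesis using fin by (simp add: card_image_le)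
    qed
    then have "card (ran \<phi>) < card C" using dom_le Suc.prems(4) by simp
    then have "\<not> C \<subseteq> ran \<phi>"
      using card_mono[OF finite_ran[OF fin]] by (meson not_less)
    then obtain c where c: "c \<in> C" "c \<notin> ran \<phi>" by blast
    have C': "finite (C - {c})" "card (C - {c}) = n"
      using Suc.prems(3,4) c(1) by auto
    have "\<exists>f. proper_edge_coloring_with (?H b) (C - {c}) f \<and> extends_precoloring f (\<phi> |` ?H b)"
      for b
    proof -
      have "ran (\<phi> |` ?H b) \<subseteq> C - {c}"
        using pre c(2) by (auto simp: edge_precoloring_def ran_def restrict_map_def split: if_splits)
      then have half: "edge_precoloring (?H b) (C - {c}) (\<phi> |` ?H b)"
        by (intro edge_precoloring_restrict[OF pre]) auto
      have "dom (\<phi> |` ?H b) \<subset> dom \<phi>" using False by auto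
      then have "card (dom (\<phi> |` ?H b)) < card (dom \<phi>)" using fin by (simp add: psubset_card_mono)
      then have "card (dom (\<phi> |` ?H b)) \<le> n - 1"
        using dom_le by simp
      moreover have "finite (dom (\<phi> |` ?H b))"
        unfolding dom_restrict using fin by (rule finite_Int[OF disjI1])
      ultimately show ?thesis using Suc.IH[OF J' C' half] by blast
    qed
    then obtain f where f: "\<And>b. proper_edge_coloring_with (?H b) (C - {c}) (f b)"
        "\<And>b. extends_precoloring (f b) (\<phi> |` ?H b)"
      by metis
    obtain F where F: "proper_edge_coloring_with (subcube_edges J v) C F"
        "\<And>b e. e \<in> ?H b \<Longrightarrow> F e = f b e"
      using color_from_two_halves[OF i c(1) f(1)] by blast
    have "\<phi> e = Some (F e)" if e: "e \<in> dom \<phi>" for e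
    proof -
      obtain b where "e \<in> ?H b" using dom_half[OF e] by blast
      then show ?thesis
        using e F(2) extends_precoloring_restrict[OF f(2)] by fastforce
    qed
    then show ?thesis using F(1) by (auto simp: extends_precoloring_def)
  qed
qed

text \<open>A function that is extensional on \<open>{..<d}\<close> has the value \<open>undefined\<close> elsewhere.\<close>

lemma hypercube_verts_eq_subcube: "hypercube_verts d = subcube {..<d} (\<lambda>_. undefined)"
  by (auto simp: hypercube_verts_def subcube_def PiE_def extensional_def)

lemma hypercube_edges_eq_subcube_edges:
  "hypercube_edges d = subcube_edges {..<d} (\<lambda>_. undefined)"
proof (intro set_eqI iffI)
  fix e assume "e \<in> hypercube_edges d"
  then obtain x y where e: "e = {x, y}"
    and xy: "x \<in> hypercube_verts d" "y \<in> hypercube_verts d" "card {i \<in> {..<d}. x i \<noteq> y i} = 1"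
    by (auto simp: hypercube_edges_def)
  obtain i where i: "{i \<in> {..<d}. x i \<noteq> y i} = {i}"
    using xy(3) by (auto simp: card_1_singleton_iff)
  have "y k = (x(i := \<not> x i)) k" for k
  proof (cases "k < d")
    case True
    then show ?thesis using i by (cases "k = i") auto
  next
    case False
    moreover have "i < d" using i by blast
    ultimately show ?thesis
      using xy(1,2) by (auto simp: hypercube_verts_eq_subcube subcube_def)
  qed
  then have "e = edge_at x i" using e by (auto simp: edge_at_def)
  moreover have "i \<in> {..<d}" using i by blast
  ultimately show "e \<in> subcube_edges {..<d} (\<lambda>_. undefined)"
    using xy(1) by (simp add: hypercube_verts_eq_subcube edge_at_in_subcube_edges)
next
  fix e assume "e \<in> subcube_edges {..<d} (\<lambda>_. undefined)"
  then obtain x i where x: "x \<in> hypercube_verts d" "i < d" "e = edge_at x i"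
    by (auto simp: subcube_edges_def hypercube_verts_eq_subcube)
  have "x(i := \<not> x i) \<in> hypercube_verts d"
    using x(1,2) by (auto simp: hypercube_verts_eq_subcube subcube_def)
  moreover have "{k \<in> {..<d}. x k \<noteq> (x(i := \<not> x i)) k} = {i}"
    using x(2) by auto
  then have "card {k \<in> {..<d}. x k \<noteq> (x(i := \<not> x i)) k} = 1" by simp
  ultimately show "e \<in> hypercube_edges d"
    using x(1,3) unfolding hypercube_edges_def edge_at_def by blast
qed

lemma finite_hypercube_edges: "finite (hypercube_edges d)"
proof (rule finite_subset)
  show "hypercube_edges d \<subseteq> Pow (hypercube_verts d)" by (auto simp: hypercube_edges_def)
  show "finite (Pow (hypercube_verts d))" by (simp add: hypercube_verts_def finite_PiE)
qed

theorem theorem3p1: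
  fixes d :: nat and \<phi> :: "(nat \<Rightarrow> bool) set \<rightharpoonup> nat"
  assumes "d \<ge> 2"
    and "edge_precoloring (hypercube_edges d) {1..d} \<phi>"
    and "card (dom \<phi>) \<le> d - 1"
  shows "\<exists>f. proper_d_edge_coloring (hypercube_edges d) d f \<and> extends_precoloring f \<phi>"
proof -
  have "finite (dom \<phi>)"
    using assms(2) finite_hypercube_edges finite_subset by (auto simp: edge_precoloring_def)
  then show ?thesis
    using extend_subcube_precoloring[of "{..<d}" d "{1..d}" "\<lambda>_. undefined" \<phi>] assms(2,3)
    by (simp add: hypercube_edges_eq_subcube_edges proper_edge_coloring_with_def
        proper_d_edge_coloring_def)
qed

end
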